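(* Let $\mathcal{D}$ be the generating class of a hierarchical model for $m$-way contingency tables. Let $\mathcal{F}_{\mathbf{b}}$ be a degree two fiber such that $\bar\Delta_{\mathbf{b}}\neq\varnothing$, and let $c(\mathbf{b})$ be the number of connected components of $\mathcal{G}(\bar\Delta_{\mathbf{b}})$. Then $$|\mathcal{F}_{\mathbf{b}}|=2^{c(\mathbf{b})-1}.$$
   Context: Let $\Delta=\{1,\dots,m\}$ be the set of variables; variable $\delta$ has level set $\mathcal{I}_\delta=\{0,1,\dots,I_\delta-1\}$, and the cells are $i=(i_1,\dots,i_m)\in\mathcal{I}=\prod_{\delta\in\Delta}\mathcal{I}_\delta$. A contingency table is a nonnegative integer array $\mathbf{n}=\{n(i)\}_{i\in\mathcal{I}}$; its sample size is $\sum_i n(i)$. For $D\subset\Delta$, $\mathcal{I}_D=\prod_{\delta\in D}\mathcal{I}_\delta$, and the $D$-marginal table $\mathbf{n}_D$ has entries $n_D(i_D)=\sum_{i_{D^C}\in\mathcal{I}_{D^C}}n(i_D,i_{D^C})$. The generating class $\mathcal{D}=\{D_1,\dots,D_r\}$ is the set of facets of a simplicial complex with $\bigcup_jD_j=\Delta$. The independence graph $\mathcal{G}^{\mathcal{D}}$ has vertex set $\Delta$, with distinct $\delta,\delta'$ adjacent iff $\delta,\delta'\in D$ for some $D\in\mathcal{D}$. The marginal frequencies of $\mathbf{n}$ are $\mathbf{b}=A\mathbf{n}=\{n_{D_j}(i_{D_j}) : i_{D_j}\in\mathcal{I}_{D_j},\ j=1,\dots,r\}$, and the fiber is $\mathcal{F}_{\mathbf{b}}=\{\mathbf{n}\ge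 0\mid A\mathbf{n}=\mathbf{b}\}$. A degree two fiber is a fiber $\mathcal{F}_{\mathbf{b}}$ where $\mathbf{b}$ is the set of marginal frequencies of some contingency table with sample size two. For such $\mathbf{b}$, the one-dimensional marginals $n_{\{\delta\}}$ are determined by $\mathbf{b}$. The variable $\delta$ is degenerate if $n_{\{\delta\}}(i_\delta)=2$ for some level $i_\delta$, and non-degenerate otherwise (then exactly two levels have one-dimensional marginal frequency $1$). $\bar\Delta_{\mathbf{b}}$ is the set of non-degenerate variables, and $\mathcal{G}(\bar\Delta_{\mathbf{b}})$ is the subgraph of $\mathcal{G}^{\mathcal{D}}$ induced by $\bar\Delta_{\mathbf{b}}$. *)

theory Defs
  imports "HOL-Analysis.Finite_Product_Measure"
begin

section \<open>Generating classes and independence graphs\<close>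

definition abstract_simplicial_complex :: "'v set \<Rightarrow> 'v set set \<Rightarrow> bool" where
  "abstract_simplicial_complex V K \<longleftrightarrow>
     K \<subseteq> Pow V \<and> (\<forall>F\<in>K. \<forall>G. G \<subseteq> F \<longrightarrow> G \<in> K)"

definition facets :: "'v set set \<Rightarrow> 'v set set" where
  "facets K = {F \<in> K. \<forall>G\<in>K. F \<subseteq> G \<longrightarrow> G = F}"

definition generating_class :: "nat \<Rightarrow> nat set set \<Rightarrow> bool" where
  "generating_class m \<D> \<longleftrightarrow>
     (\<exists>K. abstract_simplicial_complex {1..m} K \<and> \<D> = facets K) \<and> \<Union>\<D> = {1..m}"

text \<open>A simple graph is a pair of a vertex set and a symmetric irreflexive adjacency relation.\<close>

type_synonym 'v ugraph = "'v set \<times> ('v \<times> 'v) set"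

definition independence_graph :: "nat \<Rightarrow> nat set set \<Rightarrow> nat ugraph" where
  "independence_graph m \<D> =
     ({1..m}, {(u, v) \<in> {1..m} \<times> {1..m}. u \<noteq> v \<and> (\<exists>D\<in>\<D>. u \<in> D \<and> v \<in> D)})"

definition induced_subgraph :: "'v ugraph \<Rightarrow> 'v set \<Rightarrow> 'v ugraph" where
  "induced_subgraph G W = (fst G \<inter> W, snd G \<inter> W \<times> W)"

definition graph_components :: "'v ugraph \<Rightarrow> 'v set set" where
  "graph_components G = fst G // {(u, v) \<in> fst G \<times> fst G. (u, v) \<in> (snd G)\<^sup>*}"

section \<open>Contingency tables, marginals and fibers\<close>

text \<open>
  Throughout, the variables are \<open>1, \<dots>, m\<close>, variable \<open>\<delta>\<close> has levels \<open>0, \<dots>, lev \<delta> - 1\<close>,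
  and \<open>cells lev D\<close> is the set of marginal cells over \<open>D\<close>.  Cells, tables and families of
  marginal frequencies are extensional functions (\<open>undefined\<close> off their domain), so that
  equality of functions is equality of the arrays they represent.
\<close>

definition cells :: "(nat \<Rightarrow> nat) \<Rightarrow> nat set \<Rightarrow> (nat \<Rightarrow> nat) set" where
  "cells lev D = (\<Pi>\<^sub>E \<delta>\<in>D. {..<lev \<delta>})"

definition tables :: "nat \<Rightarrow> (nat \<Rightarrow> nat) \<Rightarrow> ((nat \<Rightarrow> nat) \<Rightarrow> nat) set" where
  "tables m lev = cells lev {1..m} \<rightarrow>\<^sub>E UNIV"

definition sample_size :: "nat \<Rightarrow> (nat \<Rightarrow> nat) \<Rightarrow> ((nat \<Rightarrow> nat) \<Rightarrow> nat) \<Rightarrow> nat" where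
  "sample_size m lev n = (\<Sum>i\<in>cells lev {1..m}. n i)"

definition marginal ::
    "nat \<Rightarrow> (nat \<Rightarrow> nat) \<Rightarrow> ((nat \<Rightarrow> nat) \<Rightarrow> nat) \<Rightarrow> nat set \<Rightarrow> (nat \<Rightarrow> nat) \<Rightarrow> nat" where
  "marginal m lev n D =
     (\<lambda>x\<in>cells lev D. \<Sum>y\<in>cells lev ({1..m} - D). n (merge D ({1..m} - D) (x, y)))"

definition marginal_frequencies ::
    "nat \<Rightarrow> (nat \<Rightarrow> nat) \<Rightarrow> nat set set \<Rightarrow> ((nat \<Rightarrow> nat) \<Rightarrow> nat) \<Rightarrow>
      nat set \<Rightarrow> (nat \<Rightarrow> nat) \<Rightarrow> nat" where
  "marginal_frequencies m lev \<D> n = (\<lambda>D\<in>\<D>. marginal m lev n D)"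

definition fiber ::
    "nat \<Rightarrow> (nat \<Rightarrow> nat) \<Rightarrow> nat set set \<Rightarrow> (nat set \<Rightarrow> (nat \<Rightarrow> nat) \<Rightarrow> nat) \<Rightarrow>
      ((nat \<Rightarrow> nat) \<Rightarrow> nat) set" where
  "fiber m lev \<D> b = {n \<in> tables m lev. marginal_frequencies m lev \<D> n = b}"

definition degree_two ::
    "nat \<Rightarrow> (nat \<Rightarrow> nat) \<Rightarrow> nat set set \<Rightarrow> (nat set \<Rightarrow> (nat \<Rightarrow> nat) \<Rightarrow> nat) \<Rightarrow> bool" where
  "degree_two m lev \<D> b \<longleftrightarrow>
     (\<exists>n\<in>tables m lev. sample_size m lev n = 2 \<and> b = marginal_frequencies m lev \<D> n)"

text \<open>
  The one-dimensional marginal frequency of level \<open>k\<close> of variable \<open>\<delta>\<close> as determined by \<open>b\<close>: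
  the common value of \<open>n\<^bsub>{\<delta>}\<^esub>(k)\<close> over all tables \<open>n\<close> in the fiber.  It is well defined
  by \<open>one_marginal_eq\<close> below.
\<close>

definition one_marginal ::
    "nat \<Rightarrow> (nat \<Rightarrow> nat) \<Rightarrow> nat set set \<Rightarrow> (nat set \<Rightarrow> (nat \<Rightarrow> nat) \<Rightarrow> nat) \<Rightarrow>
      nat \<Rightarrow> nat \<Rightarrow> nat" where
  "one_marginal m lev \<D> b \<delta> k =
     (THE f. \<forall>n\<in>fiber m lev \<D> b. marginal m lev n {\<delta>} (\<lambda>_\<in>{\<delta>}. k) = f)"

definition degenerate ::
    "nat \<Rightarrow> (nat \<Rightarrow> nat) \<Rightarrow> nat set set \<Rightarrow> (nat set \<Rightarrow> (nat \<Rightarrow> nat) \<Rightarrow> nat) \<Rightarrow> nat \<Rightarrow> bool" where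
  "degenerate m lev \<D> b \<delta> \<longleftrightarrow> (\<exists>k<lev \<delta>. one_marginal m lev \<D> b \<delta> k = 2)"

definition nondegenerate_variables ::
    "nat \<Rightarrow> (nat \<Rightarrow> nat) \<Rightarrow> nat set set \<Rightarrow> (nat set \<Rightarrow> (nat \<Rightarrow> nat) \<Rightarrow> nat) \<Rightarrow> nat set" where
  "nondegenerate_variables m lev \<D> b = {\<delta> \<in> {1..m}. \<not> degenerate m lev \<D> b \<delta>}"

section \<open>One-dimensional marginals are determined by the marginal frequencies\<close>

lemma finite_cells: "finite D \<Longrightarrow> finite (cells lev D)"
  by (auto simp: cells_def intro!: finite_PiE)

lemma marginal_eq_sum_restrict:
  assumes "D \<subseteq> {1..m}" "x \<in> cells lev D"
  shows "marginal m lev n D x = (\<Sum>i | i \<in> cells lev {1..m} \<and> restrict i D = x. n i)"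
proof -
  let ?E = "{1..m} - D"
  have "(\<Sum>y\<in>cells lev ?E. n (merge D ?E (x, y)))
      = (\<Sum>i | i \<in> cells lev {1..m} \<and> restrict i D = x. n i)"
  proof (rule sum.reindex_bij_witness[where i = "\<lambda>i. restrict i ?E"
        and j = "\<lambda>y. merge D ?E (x, y)"])
    fix y assume y: "y \<in> cells lev ?E"
    show "restrict (merge D ?E (x, y)) ?E = y"
      using y by (auto simp: merge_def fun_eq_iff cells_def PiE_def extensional_def)
    show "merge D ?E (x, y) \<in> {i \<in> cells lev {1..m}. restrict i D = x}"
      using y assms
      by (fastforce simp: merge_def fun_eq_iff cells_def PiE_def Pi_def extensional_def)
  next
    fix i assume i: "i \<in> {i \<in> cells lev {1..m}. restrict i D = x}"
    then have x: "x = restrict i D" by simp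
    show "merge D ?E (x, restrict i ?E) = i"
      using i assms unfolding x by (auto simp: merge_def fun_eq_iff cells_def PiE_def extensional_def)
    show "restrict i ?E \<in> cells lev ?E"
      using i by (auto simp: cells_def)
  qed simp
  then show ?thesis
    using assms by (simp add: marginal_def)
qed

lemma marginal_singleton_eq_sum_marginal:
  assumes "D \<subseteq> {1..m}" "\<delta> \<in> D" "k < lev \<delta>"
  shows "marginal m lev n {\<delta>} (\<lambda>_\<in>{\<delta>}. k) = (\<Sum>x | x \<in> cells lev D \<and> x \<delta> = k. marginal m lev n D x)"
proof -
  let ?C = "cells lev {1..m}"
  have fin: "finite ?C" "finite (cells lev D)"
    using assms finite_subset[of D "{1..m}"] by (auto intro!: finite_cells)
  have k: "(\<lambda>_\<in>{\<delta>}. k) \<in> cells lev {\<delta>}"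
    using assms by (auto simp: cells_def)
  have "(\<Sum>x | x \<in> cells lev D \<and> x \<delta> = k. marginal m lev n D x)
      = (\<Sum>x | x \<in> cells lev D \<and> x \<delta> = k. \<Sum>i | i \<in> {i \<in> ?C. i \<delta> = k} \<and> restrict i D = x. n i)"
    using assms by (intro sum.cong) (auto simp: marginal_eq_sum_restrict intro!: sum.cong)
  also have "\<dots> = (\<Sum>i | i \<in> ?C \<and> i \<delta> = k. n i)"
    using assms fin by (intro sum.group) (auto simp: cells_def)
  also have "\<dots> = (\<Sum>i | i \<in> ?C \<and> restrict i {\<delta>} = (\<lambda>_\<in>{\<delta>}. k). n i)"
    by (intro sum.cong) (auto simp: fun_eq_iff restrict_def split: if_splits)
  also have "\<dots> = marginal m lev n {\<delta>} (\<lambda>_\<in>{\<delta>}. k)"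
    using assms k by (subst marginal_eq_sum_restrict) auto
  finally show ?thesis ..
qed

lemma one_marginal_eq:
  assumes "\<Union>\<D> = {1..m}" "n \<in> fiber m lev \<D> b" "\<delta> \<in> {1..m}" "k < lev \<delta>"
  shows "one_marginal m lev \<D> b \<delta> k = marginal m lev n {\<delta>} (\<lambda>_\<in>{\<delta>}. k)"
proof -
  obtain D where D: "D \<in> \<D>" "\<delta> \<in> D" "D \<subseteq> {1..m}"
    using assms by blast
  have *: "marginal m lev n' {\<delta>} (\<lambda>_\<in>{\<delta>}. k) = (\<Sum>x | x \<in> cells lev D \<and> x \<delta> = k. b D x)"
    if "n' \<in> fiber m lev \<D> b" for n'
  proof -
    have "b D = marginal m lev n' D"
      using that D by (auto simp: fiber_def marginal_frequencies_def)
    then show ?thesis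
      using marginal_singleton_eq_sum_marginal[of D m \<delta> k lev n'] D assms by simp
  qed
  show ?thesis
    unfolding one_marginal_def using assms(2) * by (intro the_equality) auto
qed

end

theory Submission
  imports Defs
begin

text \<open>
  A table of sample size two is the sum of the indicators of two cells \<open>i\<close> and \<open>j\<close>, and the
  non-degenerate variables are those at which \<open>i\<close> and \<open>j\<close> differ.  The marginals over \<open>D\<close>
  determine the unordered pair of restrictions of \<open>i\<close> and \<open>j\<close> to \<open>D\<close>.  Hence every member of
  the fiber arises by exchanging the coordinates of \<open>i\<close> and \<open>j\<close> on a set \<open>S\<close> of non-degenerate
  variables that each \<open>D\<close> either contains, up to degenerate variables, or misses; that is, on a
  union of connected components.  Only \<open>S\<close> and its complement yield the same table, so fixing a
  non-degenerate variable \<open>w\<close> and requiring \<open>w \<notin> S\<close> leaves a free choice of the components not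
  containing \<open>w\<close>.
\<close>

section \<open>Saturated sets of an equivalence relation\<close>

text \<open>A saturated set is the disjoint union of the classes it contains, so it amounts to a
  free choice of classes; avoiding \<open>w\<close> means leaving out the class of
  \<open>w\<close>.\<close>

lemma bij_betw_Union_saturated:
  assumes "equiv V R" "w \<in> V"
  shows "bij_betw Union (Pow (V // R - {R `` {w}})) {S. S \<subseteq> V \<and> R `` S \<subseteq> S \<and> w \<notin> S}"
proof (rule bij_betw_byWitness[where f' = "\<lambda>S. {X \<in> V // R. X \<subseteq> S}"])
  show "\<forall>\<S>\<in>Pow (V // R - {R `` {w}}). {X \<in> V // R. X \<subseteq> \<Union>\<S>} = \<S>"
  proof (intro ballI equalityI subsetI)
    fix \<S> X assume \<S>: "\<S> \<in> Pow (V // R - {R `` {w}})" and X: "X \<in> {X \<in> V // R. X \<subseteq> \<Union>\<S>}"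
    \<comment> \<open>Classes are nonempty and pairwise disjoint: a point of \<open>X\<close> lies
      in some member of the family, which must then be \<open>X\<close> itself.\<close>
    obtain x where x: "x \<in> X"
      using X in_quotient_imp_non_empty[OF assms(1)] by blast
    then obtain Y where "Y \<in> \<S>" "x \<in> Y" using X by blast
    moreover have "X = Y"
      using quotient_disj[OF assms(1), of X Y] calculation X x \<S> by blast
    ultimately show "X \<in> \<S>" by simp
  qed auto
  show "\<forall>S\<in>{S. S \<subseteq> V \<and> R `` S \<subseteq> S \<and> w \<notin> S}. \<Union>{X \<in> V // R. X \<subseteq> S} = S"
  proof (intro ballI equalityI subsetI)
    fix S x assume S: "S \<in> {S. S \<subseteq> V \<and> R `` S \<subseteq> S \<and> w \<notin> S}" and x: "x \<in> S"
    have "R `` {x} \<in> V // R" "R `` {x} \<subseteq> S" "x \<in> R `` {x}"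
      using S x equiv_class_self[OF assms(1)] by (auto intro: quotientI)
    then show "x \<in> \<Union>{X \<in> V // R. X \<subseteq> S}" by blast
  qed auto
  show "Union ` Pow (V // R - {R `` {w}}) \<subseteq> {S. S \<subseteq> V \<and> R `` S \<subseteq> S \<and> w \<notin> S}"
  proof safe
    fix \<S> X x assume "\<S> \<subseteq> V // R - {R `` {w}}" "X \<in> \<S>" "x \<in> X"
    then show "x \<in> V" using in_quotient_imp_subset[OF assms(1)] by blast
  next
    fix \<S> X x y assume "\<S> \<subseteq> V // R - {R `` {w}}" "X \<in> \<S>" "x \<in> X" "(x, y) \<in> R"
    then show "y \<in> \<Union>\<S>" using in_quotient_imp_closed[OF assms(1)] by blast
  next
    fix \<S> X assume *: "\<S> \<subseteq> V // R - {R `` {w}}" "X \<in> \<S>" "w \<in> X"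
    then have "X = R `` {w}"
      using quotient_disj[OF assms(1), of X "R `` {w}"] quotientI[OF assms(2), of R]
        equiv_class_self[OF assms] by blast
    then show False using * by blast
  qed
  show "(\<lambda>S. {X \<in> V // R. X \<subseteq> S}) ` {S. S \<subseteq> V \<and> R `` S \<subseteq> S \<and> w \<notin> S}
      \<subseteq> Pow (V // R - {R `` {w}})"
    using equiv_class_self[OF assms] by blast
qed

lemma card_saturated_avoiding:
  assumes "finite V" "equiv V R" "w \<in> V"
  shows "card {S. S \<subseteq> V \<and> R `` S \<subseteq> S \<and> w \<notin> S} = 2 ^ (card (V // R) - 1)"
proof -
  have "finite (V // R)"
    using assms by (simp add: finite_quotient equiv_type)
  \<comment> \<open>The excluded class does belong to the quotient, so removing it lowers the
    cardinality by exactly one.\<close>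
  moreover have "R `` {w} \<in> V // R"
    using assms(3) by (rule quotientI)
  ultimately show ?thesis
    using bij_betw_same_card[OF bij_betw_Union_saturated[OF assms(2,3)]]
    by (simp add: card_Pow)
qed

text \<open>Closure under single edges is the same as closure under reachability, which is an
  equivalence because \<open>E\<close> is symmetric; its classes are the components.\<close>

lemma card_closed_avoiding:
  assumes "finite V" "E \<subseteq> V \<times> V" "sym E" "w \<in> V"
  shows "card {S. S \<subseteq> V \<and> E `` S \<subseteq> S \<and> w \<notin> S} = 2 ^ (card (graph_components (V, E)) - 1)"
proof -
  let ?R = "{(u, v) \<in> V \<times> V. (u, v) \<in> E\<^sup>*}"
  have R: "equiv V ?R"
  proof (rule equivI)
    show "sym ?R" using sym_rtrancl[OF assms(3)] by (auto simp: sym_def)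
  qed (auto simp: refl_on_def trans_def)
  have "?R `` S \<subseteq> S \<longleftrightarrow> E `` S \<subseteq> S" if "S \<subseteq> V" for S
  proof
    show "E `` S \<subseteq> S" if "?R `` S \<subseteq> S" using that assms(2) by blast
    show "?R `` S \<subseteq> S" if "E `` S \<subseteq> S" using Image_closed_trancl[OF that] by blast
  qed
  then have "{S. S \<subseteq> V \<and> E `` S \<subseteq> S \<and> w \<notin> S} = {S. S \<subseteq> V \<and> ?R `` S \<subseteq> S \<and> w \<notin> S}"
    by blast
  then show ?thesis
    using card_saturated_avoiding[OF assms(1) R assms(4)] by (simp add: graph_components_def)
qed

section \<open>Tables of sample size two\<close>

text \<open>Adding the two indicators also covers \<open>i = j\<close>, where the common cell gets
  frequency 2.\<close>

definition pair_table ::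
    "nat \<Rightarrow> (nat \<Rightarrow> nat) \<Rightarrow> (nat \<Rightarrow> nat) \<Rightarrow> (nat \<Rightarrow> nat) \<Rightarrow> (nat \<Rightarrow> nat) \<Rightarrow> nat" where
  "pair_table m lev i j = (\<lambda>c\<in>cells lev {1..m}. of_bool (i = c) + of_bool (j = c))"

lemma pair_table_in_tables: "pair_table m lev i j \<in> tables m lev"
  by (simp add: pair_table_def tables_def)

lemma pair_table_commute: "pair_table m lev i j = pair_table m lev j i"
  by (simp add: pair_table_def add.commute)

text \<open>Both sides are multiplicities in two-element multisets. Evaluating at \<open>a\<close>
  matches \<open>a\<close> with \<open>a'\<close> or \<open>b'\<close>; evaluating at
  \<open>b\<close> then settles the other element.\<close>

lemma of_bool_pair_eq_iff:
  assumes "a \<in> A" "b \<in> A" "a' \<in> A" "b' \<in> A"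
  shows "(\<forall>x\<in>A. (of_bool (a = x) + of_bool (b = x) :: nat) = of_bool (a' = x) + of_bool (b' = x))
    \<longleftrightarrow> (a = a' \<and> b = b') \<or> (a = b' \<and> b = a')"
    (is "?L \<longleftrightarrow> ?R")
proof
  assume L: ?L
  have "a' = a \<or> b' = a"
    using bspec[OF L assms(1)] by (cases "a' = a"; cases "b' = a"; simp)
  then show ?R
  proof
    assume "a' = a"
    then show ?R using bspec[OF L assms(2)] by (cases "b' = b"; simp)
  next
    assume "b' = a"
    then show ?R using bspec[OF L assms(2)] by (cases "a' = b"; simp)
  qed
qed auto

lemma extensional_eq_iff:
  "f \<in> extensional A \<Longrightarrow> g \<in> extensional A \<Longrightarrow> f = g \<longleftrightarrow> (\<forall>x\<in>A. f x = g x)"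
  by (auto intro: extensionalityI)

lemma restrict_eq_restrict_iff: "restrict f A = restrict g A \<longleftrightarrow> (\<forall>x\<in>A. f x = g x)"
  by (simp add: extensional_eq_iff[of _ A])

lemma pair_table_eq_iff:
  assumes "i \<in> cells lev {1..m}" "j \<in> cells lev {1..m}"
    and "i' \<in> cells lev {1..m}" "j' \<in> cells lev {1..m}"
  shows "pair_table m lev i j = pair_table m lev i' j' \<longleftrightarrow> (i = i' \<and> j = j') \<or> (i = j' \<and> j = i')"
proof -
  have "pair_table m lev i j = pair_table m lev i' j' \<longleftrightarrow>
    (\<forall>x\<in>cells lev {1..m}. (of_bool (i = x) + of_bool (j = x) :: nat) = of_bool (i' = x) + of_bool (j' = x))"
    by (subst extensional_eq_iff[of _ "cells lev {1..m}"]) (simp_all add: pair_table_def)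
  then show ?thesis using of_bool_pair_eq_iff[OF assms] by simp
qed

lemma restrict_in_cells: "i \<in> cells lev V \<Longrightarrow> D \<subseteq> V \<Longrightarrow> restrict i D \<in> cells lev D"
  by (auto simp: cells_def)

text \<open>Taking a marginal moves each of the two unit masses from its cell to the restriction of
  that cell.\<close>

lemma marginal_pair_table:
  assumes "D \<subseteq> {1..m}" "i \<in> cells lev {1..m}" "j \<in> cells lev {1..m}" "x \<in> cells lev D"
  shows "marginal m lev (pair_table m lev i j) D x =
    of_bool (restrict i D = x) + of_bool (restrict j D = x)"
proof -
  let ?A = "{c \<in> cells lev {1..m}. restrict c D = x}"
  have fin: "finite ?A" by (simp add: finite_cells)
  have single: "(\<Sum>c\<in>?A. of_bool (k = c)) = (of_bool (restrict k D = x) :: nat)"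
    if "k \<in> cells lev {1..m}" for k
    using that fin by (simp add: of_bool_def sum.delta')
  have "marginal m lev (pair_table m lev i j) D x
      = (\<Sum>c\<in>?A. of_bool (i = c) + of_bool (j = c))"
    using assms by (simp add: marginal_eq_sum_restrict pair_table_def)
  then show ?thesis
    by (simp only: sum.distrib single[OF assms(2)] single[OF assms(3)])
qed

lemma marginal_pair_table_eq_iff:
  assumes "D \<subseteq> {1..m}" "i \<in> cells lev {1..m}" "j \<in> cells lev {1..m}"
    and "i' \<in> cells lev {1..m}" "j' \<in> cells lev {1..m}"
  shows "marginal m lev (pair_table m lev i j) D = marginal m lev (pair_table m lev i' j') D \<longleftrightarrow>
    (restrict i D = restrict i' D \<and> restrict j D = restrict j' D) \<or>
    (restrict i D = restrict j' D \<and> restrict j D = restrict i' D)"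
proof -
  have "marginal m lev (pair_table m lev i j) D = marginal m lev (pair_table m lev i' j') D \<longleftrightarrow>
    (\<forall>x\<in>cells lev D. marginal m lev (pair_table m lev i j) D x
      = marginal m lev (pair_table m lev i' j') D x)"
    by (intro extensional_eq_iff) (simp_all add: marginal_def)
  also have "\<dots> \<longleftrightarrow> (\<forall>x\<in>cells lev D.
      (of_bool (restrict i D = x) + of_bool (restrict j D = x) :: nat)
      = of_bool (restrict i' D = x) + of_bool (restrict j' D = x))"
    using assms by (simp add: marginal_pair_table)
  finally show ?thesis
    using of_bool_pair_eq_iff[of "restrict i D" "cells lev D"] assms
    by (simp add: restrict_in_cells)
qed

text \<open>Removing one unit from a cell of positive frequency leaves a table of total 1, which is
  an indicator.\<close>

lemma sample_size_two_imp_pair_table: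
  assumes "n \<in> tables m lev" "sample_size m lev n = 2"
  obtains i j where "i \<in> cells lev {1..m}" "j \<in> cells lev {1..m}" "n = pair_table m lev i j"
proof -
  let ?C = "cells lev {1..m}"
  have fin: "finite ?C" by (simp add: finite_cells)
  obtain i where i: "i \<in> ?C" "n i \<noteq> 0"
    using assms(2) by (metis sample_size_def sum.neutral zero_neq_numeral)
  \<comment> \<open>The truncated subtraction loses nothing, since \<open>n i\<close> is
    nonzero.\<close>
  define n' where "n' c = n c - of_bool (i = c)" for c
  have n: "n c = n' c + of_bool (i = c)" for c
    using i by (auto simp: n'_def)
  have "(\<Sum>c\<in>?C. n c) = (\<Sum>c\<in>?C. n' c) + (\<Sum>c\<in>?C. of_bool (i = c))"
    unfolding n by (rule sum.distrib)
  also have "(\<Sum>c\<in>?C. of_bool (i = c)) = (1 :: nat)"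
    using i fin by (simp add: of_bool_def sum.delta')
  finally have "sum n' ?C = 1"
    using assms(2) by (simp add: sample_size_def)
  then obtain j where j: "j \<in> ?C" "n' j = 1" "\<And>c. c \<in> ?C \<Longrightarrow> j \<noteq> c \<Longrightarrow> n' c = 0"
    using sum_eq_1_iff[OF fin, of n'] by blast
  have "n = pair_table m lev i j"
  proof (rule extensionalityI[of _ ?C])
    show "n \<in> extensional ?C" using assms(1) by (simp add: tables_def PiE_def)
    show "pair_table m lev i j \<in> extensional ?C" by (simp add: pair_table_def)
    show "n c = pair_table m lev i j c" if "c \<in> ?C" for c
      using that j n[of c] by (cases "c = j") (auto simp: pair_table_def)
  qed
  then show thesis using that i j by blast
qed

text \<open>Restriction to \<open>D\<close> partitions the full cells by their image, so each is
  counted once.\<close>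

lemma sum_marginal_eq_sample_size:
  assumes "D \<subseteq> {1..m}"
  shows "(\<Sum>x\<in>cells lev D. marginal m lev n D x) = sample_size m lev n"
proof -
  have "(\<Sum>x\<in>cells lev D. marginal m lev n D x)
      = (\<Sum>x\<in>cells lev D. \<Sum>i | i \<in> cells lev {1..m} \<and> restrict i D = x. n i)"
    using assms by (simp add: marginal_eq_sum_restrict)
  also have "\<dots> = sample_size m lev n"
    unfolding sample_size_def using assms finite_subset[OF assms]
    by (intro sum.group) (auto simp: finite_cells restrict_in_cells)
  finally show ?thesis .
qed

lemma override_on_in_cells:
  "i \<in> cells lev V \<Longrightarrow> j \<in> cells lev V \<Longrightarrow> override_on i j S \<in> cells lev V"
  by (auto simp: cells_def override_on_def PiE_iff extensional_def)

section \<open>Fibers of degree two\<close>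

text \<open>Each \<open>D\<close> decides separately whether its coordinates are kept or exchanged;
  only overlaps between different members of \<open>\<D>\<close> tie these decisions
  together.\<close>

lemma fiber_pair_table_iff:
  assumes "\<Union>\<D> = {1..m}"
    and "i \<in> cells lev {1..m}" "j \<in> cells lev {1..m}"
    and "i' \<in> cells lev {1..m}" "j' \<in> cells lev {1..m}"
  shows "pair_table m lev i' j' \<in> fiber m lev \<D> (marginal_frequencies m lev \<D> (pair_table m lev i j))
    \<longleftrightarrow> (\<forall>D\<in>\<D>. (\<forall>\<delta>\<in>D. i' \<delta> = i \<delta> \<and> j' \<delta> = j \<delta>) \<or> (\<forall>\<delta>\<in>D. i' \<delta> = j \<delta> \<and> j' \<delta> = i \<delta>))"
proof -
  have "pair_table m lev i' j' \<in> fiber m lev \<D> (marginal_frequencies m lev \<D> (pair_table m lev i j))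
    \<longleftrightarrow> (\<forall>D\<in>\<D>. marginal m lev (pair_table m lev i' j') D = marginal m lev (pair_table m lev i j) D)"
    by (simp add: fiber_def marginal_frequencies_def pair_table_in_tables
        extensional_eq_iff[of _ \<D>])
  also have "\<dots> \<longleftrightarrow> (\<forall>D\<in>\<D>. (restrict i' D = restrict i D \<and> restrict j' D = restrict j D) \<or>
      (restrict i' D = restrict j D \<and> restrict j' D = restrict i D))"
    using assms by (intro ball_cong refl marginal_pair_table_eq_iff) auto
  finally show ?thesis by (simp only: restrict_eq_restrict_iff ball_conj_distrib)
qed

text \<open>A single marginal already determines the sample size, so every table in the fiber
  inherits the value 2.\<close>

lemma fiber_imp_pair_table:
  assumes "D \<in> \<D>" "D \<subseteq> {1..m}" "sample_size m lev n0 = 2"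
    and "n \<in> fiber m lev \<D> (marginal_frequencies m lev \<D> n0)"
  obtains i j where "i \<in> cells lev {1..m}" "j \<in> cells lev {1..m}" "n = pair_table m lev i j"
proof -
  have "marginal m lev n D = marginal m lev n0 D"
    using assms(1,4) by (auto simp: fiber_def marginal_frequencies_def dest!: fun_cong[of _ _ D])
  then have "sample_size m lev n = 2"
    using sum_marginal_eq_sample_size[OF assms(2)] assms(3) by metis
  then show thesis
    using sample_size_two_imp_pair_table[of n m lev] assms(4) that by (auto simp: fiber_def)
qed

lemma nondegenerate_variables_pair_table:
  assumes "\<Union>\<D> = {1..m}" "i \<in> cells lev {1..m}" "j \<in> cells lev {1..m}"
  shows "nondegenerate_variables m lev \<D> (marginal_frequencies m lev \<D> (pair_table m lev i j))
    = {\<delta> \<in> {1..m}. i \<delta> \<noteq> j \<delta>}"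
proof -
  let ?b = "marginal_frequencies m lev \<D> (pair_table m lev i j)"
  have "degenerate m lev \<D> ?b \<delta> \<longleftrightarrow> i \<delta> = j \<delta>" if \<delta>: "\<delta> \<in> {1..m}" for \<delta>
  proof -
    have restr: "restrict c {\<delta>} = (\<lambda>_\<in>{\<delta>}. k) \<longleftrightarrow> c \<delta> = k" for c :: "nat \<Rightarrow> nat" and k
      by (auto simp: fun_eq_iff restrict_def)
    have "one_marginal m lev \<D> ?b \<delta> k = of_bool (i \<delta> = k) + of_bool (j \<delta> = k)" if "k < lev \<delta>" for k
    proof -
      have "one_marginal m lev \<D> ?b \<delta> k = marginal m lev (pair_table m lev i j) {\<delta>} (\<lambda>_\<in>{\<delta>}. k)"
        using assms \<delta> that
        by (intro one_marginal_eq) (auto simp: fiber_def pair_table_in_tables)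
      also have "(\<lambda>_\<in>{\<delta>}. k) \<in> cells lev {\<delta>}"
        using that by (auto simp: cells_def)
      then have "marginal m lev (pair_table m lev i j) {\<delta>} (\<lambda>_\<in>{\<delta>}. k)
          = of_bool (i \<delta> = k) + of_bool (j \<delta> = k)"
        using assms \<delta> by (simp add: marginal_pair_table restr)
      finally show ?thesis .
    qed
    \<comment> \<open>If the cells agree at \<open>\<delta>\<close>, the level
      \<open>i \<delta>\<close> is the witness for degeneracy, so it must be in range.\<close>
    moreover have "i \<delta> < lev \<delta>"
      using assms(2) \<delta> by (auto simp: cells_def)
    ultimately show ?thesis
      by (auto simp: degenerate_def of_bool_def split: if_splits)
  qed
  then show ?thesis by (auto simp: nondegenerate_variables_def)
qed

text \<open>Closure of \<open>S\<close> under \<open>E\<close> says that each \<open>D\<close> has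
  its non-degenerate variables all inside or all outside \<open>S\<close>. The condition on
  \<open>w\<close> picks one of \<open>S\<close> and \<open>W - S\<close>, which give the same
  table.\<close>

lemma bij_betw_exchange_fiber:
  fixes m :: nat and lev i j :: "nat \<Rightarrow> nat" and \<D> :: "nat set set"
  defines "W \<equiv> {\<delta> \<in> {1..m}. i \<delta> \<noteq> j \<delta>}"
  defines "b \<equiv> marginal_frequencies m lev \<D> (pair_table m lev i j)"
  defines "E \<equiv> snd (induced_subgraph (independence_graph m \<D>) W)"
  assumes \<D>: "\<Union>\<D> = {1..m}"
    and i: "i \<in> cells lev {1..m}" and j: "j \<in> cells lev {1..m}" and w: "w \<in> W"
    and pairs: "\<And>n. n \<in> fiber m lev \<D> b \<Longrightarrow>
      \<exists>i'\<in>cells lev {1..m}. \<exists>j'\<in>cells lev {1..m}. n = pair_table m lev i' j'"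
  shows "bij_betw (\<lambda>S. pair_table m lev (override_on i j S) (override_on j i S))
    {S. S \<subseteq> W \<and> E `` S \<subseteq> S \<and> w \<notin> S} (fiber m lev \<D> b)"
proof (rule bij_betw_imageI)
  let ?\<S> = "{S. S \<subseteq> W \<and> E `` S \<subseteq> S \<and> w \<notin> S}"
  let ?f = "\<lambda>S. pair_table m lev (override_on i j S) (override_on j i S)"
  have cells: "override_on i j S \<in> cells lev {1..m}" "override_on j i S \<in> cells lev {1..m}" for S
    using i j by (simp_all add: override_on_in_cells)
  have E: "(u, v) \<in> E \<longleftrightarrow> u \<in> W \<and> v \<in> W \<and> u \<noteq> v \<and> (\<exists>D\<in>\<D>. u \<in> D \<and> v \<in> D)" for u v
    by (auto simp: E_def W_def induced_subgraph_def independence_graph_def)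
  show "inj_on ?f ?\<S>"
  proof (rule inj_onI)
    fix S S' assume S: "S \<in> ?\<S>" "S' \<in> ?\<S>" and eq: "?f S = ?f S'"
    \<comment> \<open>Neither set contains \<open>w\<close>, so these values are \<open>i w\<close>
      and \<open>j w\<close>; this rules out the crossed matching of the two pairs.\<close>
    have "override_on i j S w \<noteq> override_on j i S' w"
      using S w by (simp add: W_def)
    then have "override_on i j S = override_on i j S'"
      using eq w S pair_table_eq_iff[OF cells cells] by metis
    then have "\<delta> \<in> S \<longleftrightarrow> \<delta> \<in> S'" if "\<delta> \<in> W" for \<delta>
      using that by (auto simp: W_def override_on_def dest!: fun_cong[of _ _ \<delta>] split: if_splits)
    then show "S = S'" using S by blast
  qed
  show "?f ` ?\<S> = fiber m lev \<D> b"
  proof (intro equalityI subsetI)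
    fix n assume "n \<in> ?f ` ?\<S>"
    then obtain S where S: "S \<subseteq> W" "E `` S \<subseteq> S" and n: "n = ?f S" by blast
    have "(\<forall>\<delta>\<in>D. override_on i j S \<delta> = i \<delta> \<and> override_on j i S \<delta> = j \<delta>) \<or>
      (\<forall>\<delta>\<in>D. override_on i j S \<delta> = j \<delta> \<and> override_on j i S \<delta> = i \<delta>)" if D: "D \<in> \<D>" for D
    proof (cases "D \<inter> S = {}")
      case True
      then show ?thesis by (auto simp: override_on_def)
    next
      case False
      then obtain u where u: "u \<in> D" "u \<in> S" by blast
      \<comment> \<open>The variables of \<open>D\<close> in \<open>W\<close> are pairwise adjacent,
        so one of them in \<open>S\<close> draws in all others. At degenerate variables the exchange
        has no effect.\<close>
      have "\<delta> \<in> S" if "\<delta> \<in> D" "i \<delta> \<noteq> j \<delta>" for \<delta>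
      proof (cases "\<delta> = u")
        case False
        have "\<delta> \<in> W" using that D \<D> by (auto simp: W_def)
        then have "(u, \<delta>) \<in> E" using u S D that False by (auto simp: E)
        then show ?thesis using u S by blast
      qed (use u in simp)
      then show ?thesis by (auto simp: override_on_def)
    qed
    then show "n \<in> fiber m lev \<D> b"
      unfolding n b_def by (subst fiber_pair_table_iff[OF \<D> i j cells]) blast
  next
    fix n assume n: "n \<in> fiber m lev \<D> b"
    \<comment> \<open>Since \<open>pair_table\<close> is symmetric, the two cells can be named so
      that the first agrees with \<open>i\<close> at \<open>w\<close>; this gives
      \<open>w \<notin> S\<close> below.\<close>
    then obtain i' j' where i'j': "i' \<in> cells lev {1..m}" "j' \<in> cells lev {1..m}"
        "n = pair_table m lev i' j'" "i' w = i w"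
    proof -
      obtain p q where pq: "p \<in> cells lev {1..m}" "q \<in> cells lev {1..m}" "n = pair_table m lev p q"
        using pairs n by blast
      obtain D where D: "D \<in> \<D>" "w \<in> D" using w \<D> unfolding W_def by blast
      have "p w = i w \<or> q w = i w"
        using n D fiber_pair_table_iff[OF \<D> i j pq(1,2)] unfolding pq(3) b_def
        by blast
      then show thesis
        using that pq pair_table_commute by metis
    qed
    have coords: "(\<forall>\<delta>\<in>D. i' \<delta> = i \<delta> \<and> j' \<delta> = j \<delta>) \<or> (\<forall>\<delta>\<in>D. i' \<delta> = j \<delta> \<and> j' \<delta> = i \<delta>)"
      if "D \<in> \<D>" for D
      using n that fiber_pair_table_iff[OF \<D> i j i'j'(1,2)] unfolding i'j'(3) b_def by blast
    define S where "S = {\<delta> \<in> W. i' \<delta> \<noteq> i \<delta>}"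
    have "i' \<delta> = override_on i j S \<delta> \<and> j' \<delta> = override_on j i S \<delta>" if \<delta>: "\<delta> \<in> {1..m}" for \<delta>
    proof -
      obtain D where D: "D \<in> \<D>" "\<delta> \<in> D" using \<delta> \<D> by blast
      then show ?thesis using coords[of D] \<delta> by (auto simp: S_def W_def override_on_def)
    qed
    then have "i' = override_on i j S" "j' = override_on j i S"
      using i'j'(1,2) cells[of S]
      by (auto simp: cells_def PiE_def intro!: extensionalityI[of _ "{1..m}"])
    moreover have "E `` S \<subseteq> S"
    proof
      fix v assume "v \<in> E `` S"
      then obtain u D where "u \<in> S" "v \<in> W" "D \<in> \<D>" "u \<in> D" "v \<in> D"
        by (auto simp: E)
      \<comment> \<open>As \<open>u\<close> was exchanged, all of \<open>D\<close> was, and at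
        \<open>v\<close> this is a visible change because \<open>i\<close> and \<open>j\<close>
        differ there.\<close>
      then show "v \<in> S" using coords[of D] by (auto simp: S_def W_def)
    qed
    moreover have "S \<subseteq> W" "w \<notin> S"
      using i'j'(4) by (auto simp: S_def)
    ultimately show "n \<in> ?f ` ?\<S>"
      using i'j'(3) by blast
  qed
qed

theorem theorem1:
  fixes m :: nat and lev :: "nat \<Rightarrow> nat" and \<D> :: "nat set set"
    and b :: "nat set \<Rightarrow> (nat \<Rightarrow> nat) \<Rightarrow> nat"
  assumes "generating_class m \<D>"
    and "degree_two m lev \<D> b"
    and "nondegenerate_variables m lev \<D> b \<noteq> {}"
  shows "card (fiber m lev \<D> b) =
    2 ^ (card (graph_components
      (induced_subgraph (independence_graph m \<D>) (nondegenerate_variables m lev \<D> b))) - 1)"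
proof -
  have \<D>: "\<Union>\<D> = {1..m}" using assms(1) by (simp add: generating_class_def)
  obtain n0 where n0: "n0 \<in> tables m lev" "sample_size m lev n0 = 2"
      "b = marginal_frequencies m lev \<D> n0"
    using assms(2) by (auto simp: degree_two_def)
  obtain i j where i: "i \<in> cells lev {1..m}" and j: "j \<in> cells lev {1..m}"
      and ij: "n0 = pair_table m lev i j"
    using sample_size_two_imp_pair_table[OF n0(1,2)] by blast
  define W where "W = {\<delta> \<in> {1..m}. i \<delta> \<noteq> j \<delta>}"
  have W: "nondegenerate_variables m lev \<D> b = W"
    using nondegenerate_variables_pair_table[OF \<D> i j] n0(3) ij by (simp add: W_def)
  then obtain w where w: "w \<in> W" using assms(3) by blast
  then obtain D where D: "D \<in> \<D>" "w \<in> D" using \<D> unfolding W_def by blast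
  have Dm: "D \<subseteq> {1..m}" using D(1) \<D> by blast
  let ?G = "induced_subgraph (independence_graph m \<D>) W"
  have "bij_betw (\<lambda>S. pair_table m lev (override_on i j S) (override_on j i S))
      {S. S \<subseteq> W \<and> snd ?G `` S \<subseteq> S \<and> w \<notin> S} (fiber m lev \<D> b)"
    unfolding W_def n0(3) ij
  proof (rule bij_betw_exchange_fiber[OF \<D> i j])
    show "w \<in> {\<delta> \<in> {1..m}. i \<delta> \<noteq> j \<delta>}" using w by (simp add: W_def)
    show "\<exists>i'\<in>cells lev {1..m}. \<exists>j'\<in>cells lev {1..m}. n = pair_table m lev i' j'"
      if "n \<in> fiber m lev \<D> (marginal_frequencies m lev \<D> (pair_table m lev i j))" for n
      using fiber_imp_pair_table[OF D(1) Dm n0(2)] that unfolding ij by blast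
  qed
  then have "card (fiber m lev \<D> b) = card {S. S \<subseteq> W \<and> snd ?G `` S \<subseteq> S \<and> w \<notin> S}"
    by (simp add: bij_betw_same_card)
  also have "\<dots> = 2 ^ (card (graph_components (W, snd ?G)) - 1)"
    using w by (intro card_closed_avoiding)
      (auto simp: W_def induced_subgraph_def independence_graph_def sym_def)
  \<comment> \<open>The vertex set of the induced subgraph is \<open>{1..m} \<inter> W\<close>,
    which is \<open>W\<close>.\<close>
  also have "(W, snd ?G) = ?G"
    by (auto simp: W_def induced_subgraph_def independence_graph_def)
  finally show ?thesis by (simp add: W)
qed

end
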